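(* Let $\alpha=(\alpha_1,\dots,\alpha_n)$ be nonnegative integers, $m=\sum_i\alpha_i$, and let $X=(x_1,\dots,x_n)$ and $Y=(y_1,\dots,y_k)$ be tuples of formal variables. Then there exists a sijection $$D(H(Y,X,\alpha))\;\longleftrightarrow\;\prod_{1\le i<j\le n}\{x_j,-x_i\}^{\alpha_i\alpha_j}.$$
   Context: A (weighted) signed set is a finite set $S$ with a weight function $w_S$ assigning to each element a signed product of formal variables ($\pm$ a monomial); $w(S)=\sum_{s\in S}w(s)$. For signed sets $A,B$: $A+B$ is the disjoint union with inherited weights; $-A$ is a copy of $A$ with negated weights; $A-B=A+(-B)$; $A\times B$ is the Cartesian product with $w((a,b))=w(a)w(b)$, and $A^k$ the $k$-fold product (with $A^0$ a single element of weight $1$). $\{x_j,-x_i\}$ denotes a two-element signed set with weights $x_j$ and $-x_i$. A sijection between signed sets $S$ and $T$ is an involution $f$ on $S\sqcup T$ such that $w(f(x))=-w(x)$ if $x$ and $f(x)$ lie in the same one of $S,T$, and $w(f(x))=w(x)$ otherwise. For formal variables $z_1,\dots,z_r$ and an integer $k$, $B((z_1,\dots,z_r),k)$ is the signed set of tuples $(a_1,\dots,a_r)$ of nonnegative integers with $\sum a_i=k$ (empty if $k<0$), with weight $\prod z_i^{a_i}$. For $\alpha,m\ge0$, $M(Y,x,\alpha,m)$ is the $\alpha\times m$ matrix of signed sets with $(i,j)$ entry $B((y_1,\dots,y_k,x,\dots,x),j-i)$, where $x$ is repeated $i$ times. $H(Y,X,\alpha)$ is the $m\times m$ block matrix obtained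 by stacking $M(Y,x_1,\alpha_1,m),\dots,M(Y,x_n,\alpha_n,m)$ vertically. For an $N\times N$ matrix $M$ of signed sets, $D(M)$ is the signed set $\{(\sigma,(m_1,\dots,m_N)):\sigma\in S_N,\ m_i\in M_{i,\sigma(i)}\}$ with weight $\mathrm{sgn}(\sigma)\prod_i w(m_i)$. *)

theory Defs
  imports "HOL-Library.Poly_Mapping" "HOL-Library.FuncSet"
    "HOL-Combinatorics.Permutations" "Jordan_Normal_Form.Matrix"
begin

text \<open>Weights live in the polynomial ring over the integers with indeterminates of type \<open>'v\<close>.\<close>

type_synonym 'v weight = "('v \<Rightarrow>\<^sub>0 nat) \<Rightarrow>\<^sub>0 int"

definition var :: "'v \<Rightarrow> 'v weight" where
  "var v = Poly_Mapping.single (Poly_Mapping.single v 1) 1"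

definition signed_monomial :: "'v weight \<Rightarrow> bool" where
  "signed_monomial p \<longleftrightarrow>
     (\<exists>t. p = Poly_Mapping.single t 1 \<or> p = - Poly_Mapping.single t 1)"

record ('a, 'v) sset =
  elems :: "'a set"
  wt :: "'a \<Rightarrow> 'v weight"

definition signed_set :: "('a, 'v) sset \<Rightarrow> bool" where
  "signed_set S \<longleftrightarrow> finite (elems S) \<and> (\<forall>s\<in>elems S. signed_monomial (wt S s))"

definition two_sset :: "'v weight \<Rightarrow> 'v weight \<Rightarrow> (bool, 'v) sset" where
  "two_sset p q = \<lparr>elems = UNIV, wt = (\<lambda>b. if b then p else q)\<rparr>"

text \<open>The Cartesian product of a family of signed sets over a finite index set; tuples are
  extensional functions.\<close>

definition sprod :: "'i set \<Rightarrow> ('i \<Rightarrow> ('a, 'v) sset) \<Rightarrow> ('i \<Rightarrow> 'a, 'v) sset" where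
  "sprod I A = \<lparr>elems = (\<Pi>\<^sub>E i\<in>I. elems (A i)), wt = (\<lambda>a. \<Prod>i\<in>I. wt (A i) (a i))\<rparr>"

definition spow :: "('a, 'v) sset \<Rightarrow> nat \<Rightarrow> (nat \<Rightarrow> 'a, 'v) sset" where
  "spow A k = sprod {..<k} (\<lambda>_. A)"

definition disj_sum :: "('a, 'v) sset \<Rightarrow> ('b, 'v) sset \<Rightarrow> ('a + 'b, 'v) sset" where
  "disj_sum S T = \<lparr>elems = elems S <+> elems T, wt = case_sum (wt S) (wt T)\<rparr>"

definition sijection :: "('a, 'v) sset \<Rightarrow> ('b, 'v) sset \<Rightarrow> ('a + 'b \<Rightarrow> 'a + 'b) \<Rightarrow> bool" where
  "sijection S T f \<longleftrightarrow>
     signed_set S \<and> signed_set T \<and>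
     (\<forall>x\<in>elems (disj_sum S T).
        f x \<in> elems (disj_sum S T) \<and> f (f x) = x \<and>
        wt (disj_sum S T) (f x) =
          (if isl (f x) = isl x then - wt (disj_sum S T) x else wt (disj_sum S T) x))"

definition B :: "'v list \<Rightarrow> int \<Rightarrow> (nat list, 'v) sset" where
  "B z k = \<lparr>elems = {a. length a = length z \<and> int (sum_list a) = k},
            wt = (\<lambda>a. \<Prod>i<length z. var (z ! i) ^ (a ! i))\<rparr>"

text \<open>Matrix indices start at 0, so the row with index \<open>i\<close> below is row \<open>i + 1\<close> in the usual
  numbering and has \<open>x\<close> repeated \<open>i + 1\<close> times; the difference of the indices is unaffected.\<close>

definition M :: "'v list \<Rightarrow> 'v \<Rightarrow> nat \<Rightarrow> nat \<Rightarrow> (nat list, 'v) sset mat" where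
  "M Y x a m = mat a m (\<lambda>(i, j). B (Y @ replicate (Suc i) x) (int j - int i))"

definition H :: "'v list \<Rightarrow> 'v list \<Rightarrow> nat list \<Rightarrow> (nat list, 'v) sset mat" where
  "H Y X \<alpha> =
     mat_of_rows_list (sum_list \<alpha>)
       (concat (map (\<lambda>(x, a). mat_to_list (M Y x a (sum_list \<alpha>))) (zip X \<alpha>)))"

text \<open>Meant for square matrices.\<close>

definition D :: "('a, 'v) sset mat \<Rightarrow> ((nat \<Rightarrow> nat) \<times> (nat \<Rightarrow> 'a), 'v) sset" where
  "D A = \<lparr>elems = (SIGMA \<sigma>:{\<sigma>. \<sigma> permutes {0..<dim_row A}}.
                    \<Pi>\<^sub>E i\<in>{0..<dim_row A}. elems (A $$ (i, \<sigma> i))),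
          wt = (\<lambda>(\<sigma>, a). of_int (sign \<sigma>) * (\<Prod>i = 0..<dim_row A. wt (A $$ (i, \<sigma> i)) (a i)))\<rparr>"

end

theory Submission
  imports Defs "Jordan_Normal_Form.Char_Poly"
    "HOL-Computational_Algebra.Formal_Power_Series"
begin

text \<open>A sijection from \<open>S\<close> to \<open>T\<close> is a sign-reversing involution on \<open>S - T\<close>, and one exists as soon
  as the total weights of \<open>S\<close> and \<open>T\<close> agree, because elements of opposite weight can then be paired
  off greedily. It remains to evaluate a determinant. The entries in row \<open>i\<close> (counted from 0) of the
  block of \<open>x\<close> are the coefficients of the power series
  \<open>t\<^sup>i (1 - x t)\<^sup>-\<^sup>i\<^sup>-\<^sup>1 \<Prod>y. (1 - y t)\<^sup>-\<^sup>1\<close>. Splitting off the factor that depends on \<open>Y\<close>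
  leaves the confluent Vandermonde matrix with entries \<open>(j choose i) x\<^sup>j\<^sup>-\<^sup>i\<close>, the \<open>i\<close>-th Taylor
  coefficients at \<open>x\<close> of the monomials \<open>t\<^sup>j\<close>. In the Newton basis attached to the sequence of nodes
  this matrix is lower triangular.\<close>

section \<open>Sijections from equality of total weights\<close>

lemma signed_monomial_one: "signed_monomial 1"
  unfolding signed_monomial_def by (rule exI[of _ 0]) simp

lemma signed_monomial_var: "signed_monomial (var v)"
  by (auto simp: signed_monomial_def var_def)

lemma signed_monomial_uminus: "signed_monomial p \<Longrightarrow> signed_monomial (- p)"
  by (auto simp: signed_monomial_def)

lemma signed_monomial_mult:
  assumes "signed_monomial p" "signed_monomial q"
  shows "signed_monomial (p * q)"
proof -
  obtain s t where "p = Poly_Mapping.single s 1 \<or> p = - Poly_Mapping.single s 1"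
    "q = Poly_Mapping.single t 1 \<or> q = - Poly_Mapping.single t 1"
    using assms by (auto simp: signed_monomial_def)
  then show ?thesis
    unfolding signed_monomial_def by (intro exI[of _ "s + t"]) (auto simp: mult_single)
qed

lemma signed_monomial_prod:
  "(\<And>i. i \<in> I \<Longrightarrow> signed_monomial (f i)) \<Longrightarrow> signed_monomial (\<Prod>i\<in>I. f i)"
  by (induction I rule: infinite_finite_induct)
    (auto intro: signed_monomial_one signed_monomial_mult)

lemma signed_monomial_power: "signed_monomial p \<Longrightarrow> signed_monomial (p ^ k)"
  by (induction k) (auto intro: signed_monomial_one signed_monomial_mult)

lemma signed_monomial_of_int_sign: "signed_monomial (of_int (sign \<sigma>))"
  by (simp add: sign_def signed_monomial_one signed_monomial_uminus)

lemma ex_lookup_signed_monomial_nonzero: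
  "signed_monomial p \<Longrightarrow> \<exists>t. Poly_Mapping.lookup p t \<noteq> 0"
  by (auto simp: signed_monomial_def)

lemma signed_monomial_eq_or_eq_uminus:
  assumes "signed_monomial p" "signed_monomial q"
    and "Poly_Mapping.lookup p t \<noteq> 0" "Poly_Mapping.lookup q t \<noteq> 0"
  shows "q = p \<or> q = - p"
  using assms by (auto simp: signed_monomial_def lookup_single when_def split: if_splits)

lemma signed_monomial_uminus_neq:
  assumes "signed_monomial p"
  shows "- p \<noteq> p"
proof
  assume "- p = p"
  then have "Poly_Mapping.lookup p t = 0" for t
    by (metis lookup_uminus neg_equal_zero)
  then show False
    using ex_lookup_signed_monomial_nonzero[OF assms] by simp
qed

lemma exists_opposite_monomial:
  fixes u :: "'a \<Rightarrow> 'v weight"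
  assumes "finite E" "\<And>e. e \<in> E \<Longrightarrow> signed_monomial (u e)" "(\<Sum>e\<in>E. u e) = 0" "x \<in> E"
  shows "\<exists>y\<in>E. u y = - u x"
proof (rule ccontr)
  assume no_opposite: "\<not> ?thesis"
  obtain t where lookup_nonzero: "Poly_Mapping.lookup (u x) t \<noteq> 0"
    using ex_lookup_signed_monomial_nonzero[OF assms(2)[OF assms(4)]] by blast
  let ?coeff = "\<lambda>e. Poly_Mapping.lookup (u e) t"
  have nonneg: "?coeff x * ?coeff e \<ge> 0" if "e \<in> E" for e
  proof (cases "?coeff e = 0")
    case False
    then have "u e = u x \<or> u e = - u x"
      using signed_monomial_eq_or_eq_uminus[OF assms(2)[OF assms(4)] assms(2)[OF that]
          lookup_nonzero] by simp
    then have "u e = u x"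
      using no_opposite that by blast
    then show ?thesis by simp
  qed simp
  have "?coeff x * ?coeff x > 0"
    using lookup_nonzero by (simp add: zero_less_mult_iff linorder_neq_iff disj_commute)
  then have "0 < (\<Sum>e\<in>E. ?coeff x * ?coeff e)"
    using assms(1,4) nonneg by (intro sum_pos2[of E x])
  also have "\<dots> = ?coeff x * Poly_Mapping.lookup (\<Sum>e\<in>E. u e) t"
    by (simp add: lookup_sum sum_distrib_left)
  finally show False using assms(3) by simp
qed

definition sign_reversing_involution :: "'a set \<Rightarrow> ('a \<Rightarrow> 'b::uminus) \<Rightarrow> ('a \<Rightarrow> 'a) \<Rightarrow> bool" where
  "sign_reversing_involution E u f \<longleftrightarrow> (\<forall>e\<in>E. f e \<in> E \<and> f (f e) = e \<and> u (f e) = - u e)"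

lemma sign_reversing_involution_insert_pair:
  fixes u :: "'a \<Rightarrow> 'b::group_add"
  assumes "sign_reversing_involution (E - {x, y}) u f"
    and "x \<in> E" "y \<in> E" "x \<noteq> y" "u y = - u x"
  shows "sign_reversing_involution E u (f(x := y, y := x))"
  unfolding sign_reversing_involution_def
proof
  fix e assume "e \<in> E"
  then consider (pair) "e \<in> {x, y}" | (rest) "e \<in> E - {x, y}" by blast
  then show "(f(x := y, y := x)) e \<in> E
    \<and> (f(x := y, y := x)) ((f(x := y, y := x)) e) = e \<and> u ((f(x := y, y := x)) e) = - u e"
  proof cases
    case pair
    then show ?thesis using assms(2-5) by auto
  next
    case rest
    then have "f e \<in> E - {x, y}" "f (f e) = e" "u (f e) = - u e"
      using assms(1) by (simp_all add: sign_reversing_involution_def)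
    then show ?thesis using rest by simp
  qed
qed

lemma ex_sign_reversing_involution:
  fixes u :: "'a \<Rightarrow> 'v weight"
  assumes "finite E" "\<And>e. e \<in> E \<Longrightarrow> signed_monomial (u e)" "(\<Sum>e\<in>E. u e) = 0"
  shows "\<exists>f. sign_reversing_involution E u f"
  using assms
proof (induction E rule: finite_psubset_induct)
  case (psubset E)
  show ?case
  proof (cases "E = {}")
    case False
    then obtain x where "x \<in> E" by blast
    then obtain y where opposite: "y \<in> E" "u y = - u x"
      using exists_opposite_monomial[OF psubset.hyps(1) psubset.prems] by blast
    have "x \<noteq> y"
      using signed_monomial_uminus_neq[OF psubset.prems(1)[OF \<open>x \<in> E\<close>]] opposite(2) by auto
    then have "(\<Sum>e\<in>E. u e) = (\<Sum>e\<in>E - {x, y}. u e) + (u x + u y)"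
      using sum.subset_diff[of "{x, y}" E u] psubset.hyps(1) \<open>x \<in> E\<close> opposite(1) by simp
    then have "(\<Sum>e\<in>E - {x, y}. u e) = 0"
      using psubset.prems(2) opposite(2) by simp
    moreover have "E - {x, y} \<subset> E" using \<open>x \<in> E\<close> by blast
    ultimately obtain f where "sign_reversing_involution (E - {x, y}) u f"
      using psubset.IH[of "E - {x, y}"] psubset.prems(1) by auto
    then show ?thesis
      using sign_reversing_involution_insert_pair \<open>x \<in> E\<close> \<open>x \<noteq> y\<close> opposite by metis
  qed (simp add: sign_reversing_involution_def)
qed

definition total_weight :: "('a, 'v) sset \<Rightarrow> 'v weight" where
  "total_weight S = (\<Sum>s\<in>elems S. wt S s)"

definition sset_diff :: "('a, 'v) sset \<Rightarrow> ('b, 'v) sset \<Rightarrow> ('a + 'b, 'v) sset" where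
  "sset_diff S T = disj_sum S \<lparr>elems = elems T, wt = (\<lambda>t. - wt T t)\<rparr>"

lemma signed_set_sset_diff: "signed_set S \<Longrightarrow> signed_set T \<Longrightarrow> signed_set (sset_diff S T)"
  by (auto simp: signed_set_def sset_diff_def disj_sum_def signed_monomial_uminus)

lemma total_weight_sset_diff:
  assumes "finite (elems S)" "finite (elems T)"
  shows "total_weight (sset_diff S T) = total_weight S - total_weight T"
  using assms by (simp add: total_weight_def sset_diff_def disj_sum_def sum.Plus sum_negf)

lemma sijection_iff_sign_reversing_involution:
  "sijection S T f \<longleftrightarrow> signed_set S \<and> signed_set T
     \<and> sign_reversing_involution (elems (sset_diff S T)) (wt (sset_diff S T)) f"
proof -
  have elems_eq: "elems (sset_diff S T) = elems (disj_sum S T)"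
    by (simp add: sset_diff_def disj_sum_def)
  have wt_eq: "wt (sset_diff S T) y = - wt (sset_diff S T) x \<longleftrightarrow>
    wt (disj_sum S T) y = (if isl y = isl x then - wt (disj_sum S T) x else wt (disj_sum S T) x)"
    for x y
    by (cases x; cases y) (auto simp: sset_diff_def disj_sum_def minus_equation_iff)
  show ?thesis
    unfolding sijection_def sign_reversing_involution_def elems_eq wt_eq ..
qed

lemma ex_sijection_if_total_weight_eq:
  assumes "signed_set S" "signed_set T" "total_weight S = total_weight T"
  shows "\<exists>f. sijection S T f"
proof -
  have "total_weight (sset_diff S T) = 0"
    using assms by (simp add: total_weight_sset_diff signed_set_def)
  moreover have "signed_set (sset_diff S T)"
    using assms(1,2) by (rule signed_set_sset_diff)
  ultimately have "\<exists>f. sign_reversing_involution (elems (sset_diff S T)) (wt (sset_diff S T)) f"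
    by (intro ex_sign_reversing_involution) (auto simp: signed_set_def total_weight_def)
  then show ?thesis
    using assms(1,2) by (simp add: sijection_iff_sign_reversing_involution)
qed

section \<open>Total weights of the constructions\<close>

lemma signed_set_two_sset:
  "signed_monomial p \<Longrightarrow> signed_monomial q \<Longrightarrow> signed_set (two_sset p q)"
  by (simp add: signed_set_def two_sset_def)

lemma total_weight_two_sset: "total_weight (two_sset p q) = p + q"
  by (simp add: total_weight_def two_sset_def UNIV_bool add.commute)

lemma signed_set_sprod:
  assumes "finite I" "\<And>i. i \<in> I \<Longrightarrow> signed_set (A i)"
  shows "signed_set (sprod I A)"
  using assms by (auto simp: signed_set_def sprod_def PiE_mem
      intro!: finite_PiE signed_monomial_prod)

lemma total_weight_sprod:
  assumes "finite I" "\<And>i. i \<in> I \<Longrightarrow> signed_set (A i)"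
  shows "total_weight (sprod I A) = (\<Prod>i\<in>I. total_weight (A i))"
  unfolding total_weight_def sprod_def using assms
  by (simp add: prod_sum_PiE signed_set_def)

lemma signed_set_spow: "signed_set A \<Longrightarrow> signed_set (spow A k)"
  by (simp add: spow_def signed_set_sprod)

lemma total_weight_spow: "signed_set A \<Longrightarrow> total_weight (spow A k) = total_weight A ^ k"
  by (simp add: spow_def total_weight_sprod)

lemma signed_set_difference_spow: "signed_set (spow (two_sset (var v) (- var w)) k)"
  by (intro signed_set_spow signed_set_two_sset signed_monomial_uminus signed_monomial_var)

lemma total_weight_difference_spow:
  "total_weight (spow (two_sset (var v) (- var w)) k) = (var v - var w) ^ k"
  by (simp add: total_weight_spow total_weight_two_sset signed_set_two_sset
      signed_monomial_uminus signed_monomial_var)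

definition vandermonde_sset :: "'v list \<Rightarrow> nat list \<Rightarrow> (nat \<times> nat \<Rightarrow> nat \<Rightarrow> bool, 'v) sset" where
  "vandermonde_sset X \<alpha> = sprod {(i, j). i < j \<and> j < length \<alpha>}
     (\<lambda>(i, j). spow (two_sset (var (X ! j)) (- var (X ! i))) (\<alpha> ! i * \<alpha> ! j))"

lemma finite_less_pairs: "finite {(i, j). i < j \<and> j < (n::nat)}"
  by (rule finite_subset[of _ "{..<n} \<times> {..<n}"]) auto

lemma prod_less_pairs:
  fixes f :: "nat \<Rightarrow> nat \<Rightarrow> 'a::comm_monoid_mult"
  shows "(\<Prod>(i, j)\<in>{(i, j). i < j \<and> j < n}. f i j) = (\<Prod>j<n. \<Prod>i<j. f i j)"
  by (simp add: prod.Sigma)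
    (rule prod.reindex_bij_witness[of _ prod.swap prod.swap]; auto)

lemma signed_set_vandermonde_sset: "signed_set (vandermonde_sset X \<alpha>)"
  unfolding vandermonde_sset_def
  by (intro signed_set_sprod finite_less_pairs) (auto intro: signed_set_difference_spow)

lemma total_weight_vandermonde_sset:
  "total_weight (vandermonde_sset X \<alpha>)
     = (\<Prod>j<length \<alpha>. \<Prod>i<j. (var (X ! j) - var (X ! i)) ^ (\<alpha> ! i * \<alpha> ! j))"
  unfolding vandermonde_sset_def prod_less_pairs[symmetric]
  by (subst total_weight_sprod)
    (auto intro!: prod.cong finite_less_pairs signed_set_difference_spow
      simp: total_weight_difference_spow)

lemma elems_D:
  "elems (D A) = (SIGMA \<sigma>:{\<sigma>. \<sigma> permutes {0..<dim_row A}}.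
     elems (sprod {0..<dim_row A} (\<lambda>i. A $$ (i, \<sigma> i))))"
  by (simp add: D_def sprod_def)

lemma wt_D:
  "wt (D A) (\<sigma>, a) = of_int (sign \<sigma>) * wt (sprod {0..<dim_row A} (\<lambda>i. A $$ (i, \<sigma> i))) a"
  by (simp add: D_def sprod_def)

lemma signed_set_sprod_permuted_entries:
  assumes "\<And>i j. i < n \<Longrightarrow> j < n \<Longrightarrow> signed_set (A $$ (i, j))" "\<sigma> permutes {0..<n}"
  shows "signed_set (sprod {0..<n} (\<lambda>i. A $$ (i, \<sigma> i)))"
  using assms(1) permutes_in_image[OF assms(2)] by (intro signed_set_sprod) auto

lemma total_weight_sprod_permuted_entries:
  assumes "\<And>i j. i < n \<Longrightarrow> j < n \<Longrightarrow> signed_set (A $$ (i, j))" "\<sigma> permutes {0..<n}"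
  shows "total_weight (sprod {0..<n} (\<lambda>i. A $$ (i, \<sigma> i)))
       = (\<Prod>i = 0..<n. total_weight (A $$ (i, \<sigma> i)))"
  using assms(1) permutes_in_image[OF assms(2)] by (intro total_weight_sprod) auto

lemma signed_set_D:
  assumes "A \<in> carrier_mat n n" "\<And>i j. i < n \<Longrightarrow> j < n \<Longrightarrow> signed_set (A $$ (i, j))"
  shows "signed_set (D A)"
proof -
  have "dim_row A = n" using assms(1) by simp
  then show ?thesis
    using signed_set_sprod_permuted_entries[of n A] assms(2)
    by (auto simp: signed_set_def elems_D wt_D
        intro!: finite_permutations signed_monomial_mult signed_monomial_of_int_sign)
qed

lemma total_weight_D:
  assumes "A \<in> carrier_mat n n" "\<And>i j. i < n \<Longrightarrow> j < n \<Longrightarrow> signed_set (A $$ (i, j))"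
  shows "total_weight (D A) = det (map_mat total_weight A)"
proof -
  let ?P = "{\<sigma>. \<sigma> permutes {0..<n}}"
  let ?S = "\<lambda>\<sigma>. sprod {0..<n} (\<lambda>i. A $$ (i, \<sigma> i))"
  have dim: "dim_row A = n" "dim_col A = n" using assms(1) by auto
  have "\<forall>\<sigma>\<in>?P. finite (elems (?S \<sigma>))"
    using signed_set_sprod_permuted_entries[OF assms(2)] by (simp add: signed_set_def)
  then have "total_weight (D A) = (\<Sum>\<sigma>\<in>?P. \<Sum>a\<in>elems (?S \<sigma>). wt (D A) (\<sigma>, a))"
    unfolding total_weight_def elems_D dim by (subst sum.Sigma) (simp_all add: finite_permutations)
  also have "\<dots> = (\<Sum>\<sigma>\<in>?P. of_int (sign \<sigma>) * total_weight (?S \<sigma>))"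
    by (simp add: wt_D dim total_weight_def sum_distrib_left)
  also have "\<dots> = (\<Sum>\<sigma>\<in>?P. of_int (sign \<sigma>) * (\<Prod>i = 0..<n. map_mat total_weight A $$ (i, \<sigma> i)))"
    using dim by (intro sum.cong refl)
      (simp add: total_weight_sprod_permuted_entries assms(2))
  also have "\<dots> = det (map_mat total_weight A)"
    using assms(1) by (simp add: det_def'[of _ n])
  finally show ?thesis .
qed

lemma signed_set_B: "signed_set (B z k)"
proof -
  have "elems (B z k) \<subseteq> {a. set a \<subseteq> {..nat k} \<and> length a = length z}"
    by (auto simp: B_def dest: member_le_sum_list)
  then have "finite (elems (B z k))"
    by (rule finite_subset) (simp add: finite_lists_length_eq)
  then show ?thesis
    by (auto simp: signed_set_def B_def
        intro!: signed_monomial_prod signed_monomial_power signed_monomial_var)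
qed

definition geometric_fps :: "'a::comm_ring_1 \<Rightarrow> 'a fps" where
  "geometric_fps x = Abs_fps (\<lambda>n. x ^ n)"

definition complete_homogeneous_fps :: "'a::comm_ring_1 list \<Rightarrow> 'a fps" where
  "complete_homogeneous_fps zs = (\<Prod>z\<leftarrow>zs. geometric_fps z)"

lemma fps_nth_0_complete_homogeneous_fps: "fps_nth (complete_homogeneous_fps zs) 0 = 1"
  by (induction zs) (auto simp: complete_homogeneous_fps_def geometric_fps_def)

lemma total_weight_B:
  "total_weight (B z (int k)) = fps_nth (complete_homogeneous_fps (map var z)) k"
proof (cases "length z")
  case 0
  then show ?thesis
    by (auto simp: total_weight_def B_def complete_homogeneous_fps_def cong: conj_cong)
next
  case (Suc n)
  then have "complete_homogeneous_fps (map var z) = (\<Prod>i = 0..n. geometric_fps (var (z ! i)))"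
    by (simp add: complete_homogeneous_fps_def prod.list_conv_set_nth
        atLeastLessThanSuc_atLeastAtMost)
  also have "fps_nth \<dots> k = (\<Sum>a\<in>natpermute k (n + 1). \<Prod>i = 0..n. var (z ! i) ^ (a ! i))"
    by (simp only: fps_prod_nth geometric_fps_def fps_nth_Abs_fps)
  also have "\<dots> = total_weight (B z (int k))"
    using Suc by (simp add: total_weight_def B_def natpermute_def lessThan_Suc_atMost
        atMost_atLeast0 conj_commute)
  finally show ?thesis by simp
qed

lemma total_weight_B_negative: "k < 0 \<Longrightarrow> total_weight (B z k) = 0"
  by (auto simp: total_weight_def B_def intro!: sum.neutral)

lemma total_weight_B_diff:
  "total_weight (B z (int j - int i))
     = fps_nth (fps_X ^ i * complete_homogeneous_fps (map var z)) j"
proof (cases "j < i")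
  case False
  then show ?thesis
    using total_weight_B[of z "j - i"] by (simp add: fps_X_power_mult_nth of_nat_diff)
qed (simp add: total_weight_B_negative fps_X_power_mult_nth)

section \<open>Column operations\<close>

lemma det_mult_upper_triangular:
  assumes "A \<in> carrier_mat n n" "U \<in> carrier_mat n n" "upper_triangular U"
  shows "det (A * U) = det A * (\<Prod>i<n. U $$ (i, i))"
proof -
  have "det U = (\<Prod>i<n. U $$ (i, i))"
    using assms(2,3) by (simp add: det_upper_triangular prod_list_diag_prod lessThan_atLeast0)
  then show ?thesis using assms(1,2) by (simp add: det_mult)
qed

lemma det_fps_coeffs_common_factor:
  "det (mat m m (\<lambda>(r, j). fps_nth (f r * g) j))
     = det (mat m m (\<lambda>(r, j). fps_nth (f r) j)) * fps_nth g 0 ^ m"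
    (is "det ?B = det ?A * _")
proof -
  define U where "U = mat m m (\<lambda>(l, j). if l \<le> j then fps_nth g (j - l) else 0)"
  have "?B = ?A * U"
  proof (rule eq_matI)
    fix r j assume "r < dim_row (?A * U)" "j < dim_col (?A * U)"
    then have bounds: "r < m" "j < m" by (auto simp: U_def)
    have "fps_nth (f r * g) j
        = (\<Sum>l = 0..<m. fps_nth (f r) l * (if l \<le> j then fps_nth g (j - l) else 0))"
      unfolding fps_mult_nth using bounds by (intro sum.mono_neutral_cong_left) auto
    then show "?B $$ (r, j) = (?A * U) $$ (r, j)"
      using bounds by (simp add: U_def scalar_prod_def)
  qed (simp_all add: U_def)
  then show ?thesis
    by (simp add: U_def det_mult_upper_triangular[of _ m] upper_triangular_def)
qed

lemma linear_functional_conv_coeff_sum: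
  fixes p :: "'a::comm_ring_1 poly"
  assumes "module_hom smult (*) \<phi>" "degree p < m"
  shows "\<phi> p = (\<Sum>l<m. \<phi> (monom 1 l) * coeff p l)"
proof -
  interpret \<phi>: module_hom smult "(*)" \<phi> by (rule assms(1))
  have "p = (\<Sum>l<m. smult (coeff p l) (monom 1 l))"
    using poly_as_sum_of_monoms'[of p "m - 1"] assms(2)
    by (cases m) (simp_all add: smult_monom lessThan_Suc_atMost)
  then have "\<phi> p = \<phi> (\<Sum>l<m. smult (coeff p l) (monom 1 l))" by simp
  also have "\<dots> = (\<Sum>l<m. \<phi> (monom 1 l) * coeff p l)"
    by (simp add: \<phi>.sum \<phi>.scale mult.commute)
  finally show ?thesis .
qed

lemma det_linear_functionals_change_basis:
  fixes p :: "nat \<Rightarrow> 'a::comm_ring_1 poly"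
  assumes "\<And>r. r < m \<Longrightarrow> module_hom smult (*) (\<phi> r)" "\<And>j. j < m \<Longrightarrow> degree (p j) \<le> j"
  shows "det (mat m m (\<lambda>(r, j). \<phi> r (p j)))
       = det (mat m m (\<lambda>(r, j). \<phi> r (monom 1 j))) * (\<Prod>j<m. coeff (p j) j)"
    (is "det ?B = det ?A * _")
proof -
  define U where "U = mat m m (\<lambda>(l, j). coeff (p j) l)"
  have "?B = ?A * U"
  proof (rule eq_matI)
    fix r j assume "r < dim_row (?A * U)" "j < dim_col (?A * U)"
    then have bounds: "r < m" "j < m" by (auto simp: U_def)
    then have "\<phi> r (p j) = (\<Sum>l<m. \<phi> r (monom 1 l) * coeff (p j) l)"
      using assms(1) assms(2)[of j] by (intro linear_functional_conv_coeff_sum) auto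
    then show "?B $$ (r, j) = (?A * U) $$ (r, j)"
      using bounds by (simp add: U_def scalar_prod_def lessThan_atLeast0)
  qed (simp_all add: U_def)
  moreover have "upper_triangular U"
    by (intro upper_triangularI) (simp add: U_def coeff_eq_0 le_less_trans[OF assms(2)])
  ultimately show ?thesis
    by (simp add: U_def det_mult_upper_triangular[of _ m])
qed

section \<open>The confluent Vandermonde determinant\<close>

fun taylor_coeff :: "'a::comm_ring_1 \<times> nat \<Rightarrow> 'a poly \<Rightarrow> 'a" where
  "taylor_coeff (x, i) p = coeff (p \<circ>\<^sub>p [:x, 1:]) i"

lemma module_hom_taylor_coeff: "module_hom smult (*) (taylor_coeff label)"
  by (cases label, unfold_locales)
    (simp_all add: smult_add_left smult_add_right pcompose_add pcompose_smult algebra_simps)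

lemma taylor_coeff_monom: "taylor_coeff (x, i) (monom 1 l) = of_nat (l choose i) * x ^ (l - i)"
proof -
  have "taylor_coeff (x, i) (monom 1 l) = coeff ([:x, 1:] ^ l) i"
    by (simp add: monom_altdef pcompose_hom.hom_power pcompose_pCons)
  also have "\<dots> = of_nat (l choose i) * x ^ (l - i)"
    by (cases "i \<le> l")
      (simp_all add: coeff_linear_poly_power coeff_eq_0 degree_linear_power binomial_eq_0)
  finally show ?thesis .
qed

lemma taylor_coeff_mult_linear_power:
  "taylor_coeff (x, i) (p * [:-x, 1:] ^ e) = (if i < e then 0 else taylor_coeff (x, i - e) p)"
proof -
  have "[:-x, 1:] ^ e \<circ>\<^sub>p [:x, 1:] = monom 1 e"
    by (simp add: pcompose_hom.hom_power pcompose_pCons monom_altdef)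
  then show ?thesis
    by (simp add: pcompose_mult mult.commute[of _ "monom 1 e"] coeff_monom_mult)
qed

lemma taylor_coeff_0: "taylor_coeff (x, 0) p = poly p x"
  by (simp add: poly_pcompose flip: poly_0_coeff_0)

lemma lead_coeff_linear_factors:
  fixes f :: "'a \<Rightarrow> 'b::comm_ring_1"
  shows "lead_coeff (\<Prod>a\<leftarrow>as. [:f a, 1:]) = 1"
proof (induction as)
  case (Cons a as)
  let ?p = "\<Prod>a\<leftarrow>as. [:f a, 1:]"
  have "?p \<noteq> 0" using Cons.IH by auto
  then have "degree ([:f a, 1:] * ?p) = degree [:f a, 1:] + degree ?p"
    by (intro degree_monic_mult) simp_all
  then show ?case
    using lcoeff_monic_mult[of "[:f a, 1:]" ?p] Cons.IH by simp
qed simp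

definition newton_poly :: "'a::comm_ring_1 list \<Rightarrow> nat \<Rightarrow> 'a poly" where
  "newton_poly zs j = (\<Prod>z\<leftarrow>take j zs. [:-z, 1:])"

lemma degree_newton_poly: "j \<le> length zs \<Longrightarrow> degree (newton_poly zs j) = j"
  by (simp add: newton_poly_def degree_linear_factors)

lemma coeff_newton_poly:
  assumes "j \<le> length zs"
  shows "coeff (newton_poly zs j) j = 1"
  using lead_coeff_linear_factors[of uminus "take j zs"] degree_newton_poly[OF assms]
  by (simp add: newton_poly_def)

lemma newton_poly_append: "j \<le> length zs \<Longrightarrow> newton_poly (zs @ ws) j = newton_poly zs j"
  by (simp add: newton_poly_def)

lemma newton_poly_append_replicate:
  "i \<le> a \<Longrightarrow> newton_poly (zs @ replicate a x) (length zs + i)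
     = newton_poly zs (length zs) * [:-x, 1:] ^ i"
  by (simp add: newton_poly_def min_def)

lemma newton_poly_dvd:
  assumes "i \<le> j"
  shows "newton_poly zs i dvd newton_poly zs j"
proof -
  have "take j zs = take i zs @ take (j - i) (drop i zs)"
    using assms by (metis le_add_diff_inverse take_add)
  then show ?thesis by (simp add: newton_poly_def)
qed

text \<open>Row \<open>i\<close> of the block of \<open>x\<close> in a stacked matrix is labelled \<open>(x, i)\<close>.\<close>

definition row_labels :: "('a \<times> nat) list \<Rightarrow> ('a \<times> nat) list" where
  "row_labels ps = concat (map (\<lambda>(x, a). map (Pair x) [0..<a]) ps)"

lemma row_labels_snoc:
  "row_labels (ps @ [(x, a)]) = row_labels ps @ map (Pair x) [0..<a]"
  by (simp add: row_labels_def)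

lemma length_row_labels: "length (row_labels ps) = sum_list (map snd ps)"
  by (simp add: row_labels_def length_concat comp_def case_prod_beta)

lemma row_labels_map: "row_labels (map (map_prod f id) ps) = map (map_prod f id) (row_labels ps)"
  by (simp add: row_labels_def map_concat comp_def case_prod_beta)

definition row_nodes :: "('a \<times> nat) list \<Rightarrow> 'a list" where
  "row_nodes ps = map fst (row_labels ps)"

lemma length_row_nodes: "length (row_nodes ps) = length (row_labels ps)"
  by (simp add: row_nodes_def)

lemma row_nodes_snoc: "row_nodes (ps @ [(x, a)]) = row_nodes ps @ replicate a x"
  by (simp add: row_nodes_def row_labels_snoc comp_def map_replicate_const)

lemma linear_power_dvd_newton_poly:
  assumes "r < length (row_labels ps)" "row_labels ps ! r = (x, i)"
  shows "[:-x, 1:] ^ Suc i dvd newton_poly (row_nodes ps) (Suc r)"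
  using assms
proof (induction ps rule: rev_induct)
  case (snoc p ps)
  obtain y a where p_eq: "p = (y, a)" by fastforce
  show ?case
  proof (cases "r < length (row_labels ps)")
    case True
    then show ?thesis
      using snoc by (simp add: p_eq row_labels_snoc row_nodes_snoc nth_append newton_poly_append
          length_row_nodes)
  next
    case False
    then have last_block: "Suc r = length (row_nodes ps) + Suc i" "x = y" "Suc i \<le> a"
      using snoc.prems by (auto simp: p_eq row_labels_snoc nth_append length_row_nodes)
    show ?thesis
      unfolding p_eq row_nodes_snoc last_block(1,2) newton_poly_append_replicate[OF last_block(3)]
      by (rule dvd_triv_right)
  qed
qed (simp add: row_labels_def)

lemma taylor_coeff_newton_poly_eq_0:
  assumes "r < j" "j \<le> length (row_labels ps)"
  shows "taylor_coeff (row_labels ps ! r) (newton_poly (row_nodes ps) j) = 0"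
proof -
  obtain x i where label: "row_labels ps ! r = (x, i)" by fastforce
  have "[:-x, 1:] ^ Suc i dvd newton_poly (row_nodes ps) (Suc r)"
    using assms label by (intro linear_power_dvd_newton_poly) auto
  also have "\<dots> dvd newton_poly (row_nodes ps) j"
    using assms(1) by (intro newton_poly_dvd) simp
  finally obtain q where "newton_poly (row_nodes ps) j = q * [:-x, 1:] ^ Suc i"
    by (metis dvdE mult.commute)
  then show ?thesis
    by (simp only: label taylor_coeff_mult_linear_power) simp
qed

lemma poly_newton_poly_row_nodes:
  "poly (newton_poly (row_nodes ps) (length (row_nodes ps))) x
     = (\<Prod>i<length ps. (x - fst (ps ! i)) ^ snd (ps ! i))"
proof (induction ps rule: rev_induct)
  case (snoc p ps)
  obtain y a where p_eq: "p = (y, a)" by fastforce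
  show ?case
    using snoc newton_poly_append_replicate[of a a "row_nodes ps" y]
    by (simp add: p_eq row_nodes_snoc nth_append)
qed (simp add: row_nodes_def row_labels_def newton_poly_def)

lemma prod_lessThan_add:
  fixes f :: "nat \<Rightarrow> 'a::comm_monoid_mult"
  shows "(\<Prod>r<n + k. f r) = (\<Prod>r<n. f r) * (\<Prod>r<k. f (n + r))"
  by (induction k) (simp_all add: mult.assoc)

lemma prod_taylor_coeff_newton_poly:
  fixes ps :: "('a::comm_ring_1 \<times> nat) list"
  shows "(\<Prod>r<length (row_labels ps).
            taylor_coeff (row_labels ps ! r) (newton_poly (row_nodes ps) r))
       = (\<Prod>j<length ps. \<Prod>i<j. (fst (ps ! j) - fst (ps ! i)) ^ (snd (ps ! i) * snd (ps ! j)))"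
    (is "?lhs ps = (\<Prod>j<_. \<Prod>i<j. ?factor ps i j)")
proof (induction ps rule: rev_induct)
  case (snoc p ps)
  obtain x a where p_eq: "p = (x, a)" by fastforce
  let ?qs = "ps @ [(x, a)]" and ?n = "length (row_labels ps)"
  let ?term = "\<lambda>r. taylor_coeff (row_labels ?qs ! r) (newton_poly (row_nodes ?qs) r)"
  have "?lhs ?qs = (\<Prod>r<?n. ?term r) * (\<Prod>k<a. ?term (?n + k))"
    by (simp add: row_labels_snoc prod_lessThan_add)
  also have "(\<Prod>r<?n. ?term r) = ?lhs ps"
    by (intro prod.cong refl)
      (simp add: row_labels_snoc row_nodes_snoc nth_append newton_poly_append length_row_nodes)
  also have "\<dots> = (\<Prod>j<length ps. \<Prod>i<j. ?factor ?qs i j)"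
    unfolding snoc.IH by (intro prod.cong refl) (simp add: nth_append)
  also have "(\<Prod>k<a. ?term (?n + k)) = (\<Prod>k<a. \<Prod>i<length ps. (x - fst (ps ! i)) ^ snd (ps ! i))"
    using newton_poly_append_replicate[of _ a "row_nodes ps" x]
    by (intro prod.cong refl)
      (simp add: row_labels_snoc row_nodes_snoc nth_append taylor_coeff_mult_linear_power
        taylor_coeff_0 poly_newton_poly_row_nodes flip: length_row_nodes del: taylor_coeff.simps)
  also have "\<dots> = (\<Prod>i<length ps. ?factor ?qs i (length ps))"
    by (simp add: nth_append power_mult prod_power_distrib)
  finally show ?case by (simp add: p_eq)
qed (simp add: row_labels_def)

definition confluent_vandermonde :: "('a::comm_ring_1 \<times> nat) list \<Rightarrow> 'a mat" where
  "confluent_vandermonde ps = mat (length (row_labels ps)) (length (row_labels ps))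
     (\<lambda>(r, l). taylor_coeff (row_labels ps ! r) (monom 1 l))"

theorem det_confluent_vandermonde:
  "det (confluent_vandermonde ps)
     = (\<Prod>j<length ps. \<Prod>i<j. (fst (ps ! j) - fst (ps ! i)) ^ (snd (ps ! i) * snd (ps ! j)))"
proof -
  let ?m = "length (row_labels ps)"
  define L where "L = mat ?m ?m
    (\<lambda>(r, j). taylor_coeff (row_labels ps ! r) (newton_poly (row_nodes ps) j))"
  have "det (confluent_vandermonde ps) = det L"
    unfolding confluent_vandermonde_def L_def
    by (subst det_linear_functionals_change_basis)
      (simp_all add: module_hom_taylor_coeff degree_newton_poly coeff_newton_poly length_row_nodes)
  also have "\<dots> = prod_list (diag_mat L)"
    by (rule det_lower_triangular[of ?m]) (simp_all add: L_def taylor_coeff_newton_poly_eq_0)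
  also have "\<dots> = (\<Prod>r<?m. taylor_coeff (row_labels ps ! r) (newton_poly (row_nodes ps) r))"
    by (simp add: prod_list_diag_prod L_def lessThan_atLeast0)
  also have "\<dots> = (\<Prod>j<length ps. \<Prod>i<j.
      (fst (ps ! j) - fst (ps ! i)) ^ (snd (ps ! i) * snd (ps ! j)))"
    by (rule prod_taylor_coeff_newton_poly)
  finally show ?thesis .
qed

section \<open>The determinant of the block matrix\<close>

lemma fps_nth_geometric_fps_power:
  "fps_nth (geometric_fps x ^ Suc i) n = of_nat ((n + i) choose i) * x ^ n"
proof (induction i arbitrary: n)
  case (Suc i)
  have "fps_nth (geometric_fps x ^ Suc (Suc i)) n
      = (\<Sum>k=0..n. of_nat ((k + i) choose i) * x ^ k * x ^ (n - k))"
    by (subst power_Suc2) (simp only: fps_mult_nth Suc.IH, simp add: geometric_fps_def)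
  also have "\<dots> = of_nat (\<Sum>k\<le>n. (i + k) choose i) * x ^ n"
    by (simp add: sum_distrib_right atMost_atLeast0 mult.assoc add.commute flip: power_add)
  also have "(\<Sum>k\<le>n. (i + k) choose i) = (n + Suc i) choose Suc i"
    using choose_rising_sum(1)[of i n] by (simp add: add.commute)
  finally show ?case .
qed (simp add: geometric_fps_def)

fun taylor_fps :: "'a::comm_ring_1 \<times> nat \<Rightarrow> 'a fps" where
  "taylor_fps (x, i) = fps_X ^ i * geometric_fps x ^ Suc i"

lemma fps_nth_taylor_fps: "fps_nth (taylor_fps label) l = taylor_coeff label (monom 1 l)"
  by (cases label)
    (simp add: taylor_coeff_monom fps_X_power_mult_nth fps_nth_geometric_fps_power binomial_eq_0
      del: power_Suc taylor_coeff.simps)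

lemma H_conv_row_labels:
  assumes "length X = length \<alpha>"
  defines "R \<equiv> row_labels (zip X \<alpha>)"
  shows "H Y X \<alpha> = mat (length R) (length R)
    (\<lambda>(r, j). case R ! r of (x, i) \<Rightarrow> B (Y @ replicate (Suc i) x) (int j - int i))"
proof -
  let ?row = "\<lambda>(x, i). map (\<lambda>j. B (Y @ replicate (Suc i) x) (int j - int i)) [0..<sum_list \<alpha>]"
  have "concat (map (\<lambda>(x, a). mat_to_list (M Y x a (sum_list \<alpha>))) ps) = map ?row (row_labels ps)"
    for ps
    by (induction ps) (auto simp: row_labels_def mat_to_list_def M_def)
  moreover have "length R = sum_list \<alpha>"
    using assms by (simp add: length_row_labels)
  ultimately show ?thesis
    unfolding H_def mat_of_rows_list_def R_def[symmetric]
    by (intro eq_matI) (auto simp: case_prod_beta R_def)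
qed

lemma H_carrier:
  assumes "length X = length \<alpha>"
  shows "H Y X \<alpha> \<in> carrier_mat (sum_list \<alpha>) (sum_list \<alpha>)"
  using assms by (simp add: H_conv_row_labels length_row_labels)

lemma signed_set_H_entry:
  assumes "length X = length \<alpha>" "i < sum_list \<alpha>" "j < sum_list \<alpha>"
  shows "signed_set (H Y X \<alpha> $$ (i, j))"
  using assms by (simp add: H_conv_row_labels length_row_labels signed_set_B case_prod_beta)

lemma total_weight_B_append_replicate:
  "total_weight (B (Y @ replicate (Suc i) x) (int j - int i))
     = fps_nth (taylor_fps (var x, i) * complete_homogeneous_fps (map var Y)) j"
  unfolding total_weight_B_diff by (simp add: complete_homogeneous_fps_def mult_ac)

lemma det_total_weight_H:
  assumes "length X = length \<alpha>"
  shows "det (map_mat total_weight (H Y X \<alpha>))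
       = (\<Prod>j<length \<alpha>. \<Prod>i<j. (var (X ! j) - var (X ! i)) ^ (\<alpha> ! i * \<alpha> ! j))"
proof -
  define ps where "ps = zip (map var X) \<alpha>"
  let ?m = "length (row_labels ps)"
  have "ps = map (map_prod var id) (zip X \<alpha>)"
    by (simp add: ps_def zip_map1 map_prod_def)
  then have labels: "row_labels ps = map (map_prod var id) (row_labels (zip X \<alpha>))"
    by (simp add: row_labels_map)
  have "map_mat total_weight (H Y X \<alpha>) = mat ?m ?m
      (\<lambda>(r, j). fps_nth (taylor_fps (row_labels ps ! r) * complete_homogeneous_fps (map var Y)) j)"
    unfolding H_conv_row_labels[OF assms] labels
    by (intro eq_matI) (simp_all add: case_prod_beta map_prod_def total_weight_B_append_replicate
        del: replicate_Suc taylor_fps.simps)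
  then have "det (map_mat total_weight (H Y X \<alpha>))
      = det (mat ?m ?m (\<lambda>(r, j). fps_nth (taylor_fps (row_labels ps ! r)) j))"
    by (simp add: det_fps_coeffs_common_factor fps_nth_0_complete_homogeneous_fps)
  also have "mat ?m ?m (\<lambda>(r, j). fps_nth (taylor_fps (row_labels ps ! r)) j)
      = confluent_vandermonde ps"
    by (simp add: confluent_vandermonde_def fps_nth_taylor_fps)
  also have "det \<dots> = (\<Prod>j<length \<alpha>. \<Prod>i<j. (var (X ! j) - var (X ! i)) ^ (\<alpha> ! i * \<alpha> ! j))"
    unfolding det_confluent_vandermonde using assms by (simp add: ps_def)
  finally show ?thesis .
qed

theorem theorem2p27:
  fixes X Y :: "'v list" and \<alpha> :: "nat list"
  assumes "length X = length \<alpha>"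
  shows "\<exists>f. sijection (D (H Y X \<alpha>))
           (sprod {(i, j). i < j \<and> j < length \<alpha>}
             (\<lambda>(i, j). spow (two_sset (var (X ! j)) (- var (X ! i))) (\<alpha> ! i * \<alpha> ! j))) f"
proof -
  note entries = H_carrier[OF assms] signed_set_H_entry[OF assms]
  have "total_weight (D (H Y X \<alpha>)) = det (map_mat total_weight (H Y X \<alpha>))"
    using entries by (rule total_weight_D)
  also have "\<dots> = total_weight (vandermonde_sset X \<alpha>)"
    by (simp only: det_total_weight_H[OF assms] total_weight_vandermonde_sset)
  finally have "\<exists>f. sijection (D (H Y X \<alpha>)) (vandermonde_sset X \<alpha>) f"
    using signed_set_D[OF entries] signed_set_vandermonde_sset
    by (intro ex_sijection_if_total_weight_eq)
  then show ?thesis unfolding vandermonde_sset_def .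
qed

end
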